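(* Let $L$ be a linear order that is discrete, unbounded and cyclically transitive. Then $L$ is exponentiable; that is, for every ordinal $\alpha$ and all $a,b\in L$, the linear orders $(L,a)^{\alpha}$ and $(L,b)^{\alpha}$ are isomorphic.
   Context: Linear orders may be empty. $L_1+L_2$ denotes the ordered sum (disjoint union with every element of $L_1$ strictly below every element of $L_2$); a partition $L=L_1+L_2$ means that $L_1$ is an initial segment of $L$ and $L_2$ is its complement (either may be empty). A linear order $L$ is unbounded if for each $a\in L$ there are $b,c\in L$ with $b<a<c$. It is discrete if every non-greatest element has an immediate successor and every non-least element has an immediate predecessor. $L$ is cyclically transitive if for any $a\le b$ in $L$ there exist partitions $L=L_1+L_2=L_2'+L_1'$ with $a\in L_1$, $b\in L_1'$, and order isomorphisms $F_1:L_1\to L_1'$, $F_2:L_2\to L_2'$ satisfying $F_1(a)=b$. For a linear order $L$ with a chosen element $a\in L$ and a linear order $M$, the exponential $(L,a)^{M}$ is the set of all functions $M\to L$ taking the value $a$ at all but finitely many elements of $M$, ordered as follows: for distinct $f,g$, $f<g$ if and only if $f(m)<g(m)$, where $m$ is the greatest element of $M$ with $f(m)\ne g(m)$. *)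

theory Defs
  imports Main "HOL-Library.FuncSet"
begin

text \<open>
  A linear order is a reflexive relation \<open>L\<close> with \<open>Linear_order L\<close>; its carrier is \<open>Field L\<close>,
  so the empty order is included.  Its strict part is \<open>L - Id\<close>, and an ordinal is a relation
  satisfying \<open>Well_order\<close> on an arbitrary type.  Order isomorphisms are given by the library
  predicate \<^const>\<open>iso\<close>, which for arbitrary relations means a bijection between
  the fields that preserves and reflects the relations (see \<open>iso_iff2\<close>).  A subset \<open>A\<close> of
  \<open>Field L\<close> is regarded as the linear order \<open>Restr L A\<close>.
\<close>

definition unbounded_order :: "'a rel \<Rightarrow> bool" where
  "unbounded_order L \<longleftrightarrow>
     (\<forall>a \<in> Field L. \<exists>b c. (b, a) \<in> L - Id \<and> (a, c) \<in> L - Id)"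

definition immediate_succ :: "'a rel \<Rightarrow> 'a \<Rightarrow> 'a \<Rightarrow> bool" where
  "immediate_succ L x y \<longleftrightarrow>
     (x, y) \<in> L - Id \<and> \<not> (\<exists>z. (x, z) \<in> L - Id \<and> (z, y) \<in> L - Id)"

definition discrete_order :: "'a rel \<Rightarrow> bool" where
  "discrete_order L \<longleftrightarrow>
     (\<forall>x \<in> Field L. \<not> (\<forall>y \<in> Field L. (y, x) \<in> L) \<longrightarrow> (\<exists>y. immediate_succ L x y)) \<and>
     (\<forall>x \<in> Field L. \<not> (\<forall>y \<in> Field L. (x, y) \<in> L) \<longrightarrow> (\<exists>y. immediate_succ L y x))"

definition initial_segment :: "'a rel \<Rightarrow> 'a set \<Rightarrow> bool" where
  "initial_segment L A \<longleftrightarrow> A \<subseteq> Field L \<and> (\<forall>x \<in> A. \<forall>y. (y, x) \<in> L \<longrightarrow> y \<in> A)"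

text \<open>\<open>order_partition L A B\<close> expresses \<open>L = A + B\<close>.\<close>

definition order_partition :: "'a rel \<Rightarrow> 'a set \<Rightarrow> 'a set \<Rightarrow> bool" where
  "order_partition L A B \<longleftrightarrow> initial_segment L A \<and> B = Field L - A"

definition cyclically_transitive :: "'a rel \<Rightarrow> bool" where
  "cyclically_transitive L \<longleftrightarrow>
     (\<forall>a b. (a, b) \<in> L \<longrightarrow>
        (\<exists>L1 L2 L1' L2' F1 F2.
           order_partition L L1 L2 \<and> order_partition L L2' L1' \<and>
           a \<in> L1 \<and> b \<in> L1' \<and>
           iso (Restr L L1) (Restr L L1') F1 \<and>
           iso (Restr L L2) (Restr L L2') F2 \<and>
           F1 a = b))"

text \<open>
  Functions from \<open>Field M\<close> to \<open>Field L\<close> are represented by extensional functions, i.e. with the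
  dummy value \<^const>\<open>undefined\<close> outside \<open>Field M\<close>, so that distinct representatives are
  distinct functions on \<open>Field M\<close>.
\<close>

definition exp_carrier :: "'a rel \<Rightarrow> 'a \<Rightarrow> 'b rel \<Rightarrow> ('b \<Rightarrow> 'a) set" where
  "exp_carrier L a M =
     {f \<in> Field M \<rightarrow>\<^sub>E Field L. finite {m \<in> Field M. f m \<noteq> a}}"

definition exp_less :: "'a rel \<Rightarrow> 'b rel \<Rightarrow> ('b \<Rightarrow> 'a) \<Rightarrow> ('b \<Rightarrow> 'a) \<Rightarrow> bool" where
  "exp_less L M f g \<longleftrightarrow>
     (\<exists>m \<in> Field M. f m \<noteq> g m \<and> (\<forall>n \<in> Field M. f n \<noteq> g n \<longrightarrow> (n, m) \<in> M) \<and>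
        (f m, g m) \<in> L - Id)"

definition exp_order :: "'a rel \<Rightarrow> 'a \<Rightarrow> 'b rel \<Rightarrow> ('b \<Rightarrow> 'a) rel" where
  "exp_order L a M =
     {(f, g). f \<in> exp_carrier L a M \<and> g \<in> exp_carrier L a M \<and> (f = g \<or> exp_less L M f g)}"

lemma Field_exp_order [simp]: "Field (exp_order L a M) = exp_carrier L a M"
  by (auto simp: exp_order_def Field_def)

lemma finite_has_greatest:
  assumes "Linear_order M" "finite D" "D \<noteq> {}" "D \<subseteq> Field M"
  shows "\<exists>m \<in> D. \<forall>n \<in> D. (n, m) \<in> M"
  using assms(2,3,4)
proof (induction D rule: finite_ne_induct)
  case (singleton x)
  then show ?case
    using assms(1) by (auto simp: order_on_defs refl_on_def)
next
  case (insert x D)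
  then obtain m where m: "m \<in> D" "\<forall>n \<in> D. (n, m) \<in> M" by auto
  have xx: "(x, x) \<in> M" and tot: "(x, m) \<in> M \<or> (m, x) \<in> M" and tr: "trans M"
    using assms(1) insert m by (auto simp: order_on_defs refl_on_def total_on_def)
  from tot show ?case
  proof
    assume "(x, m) \<in> M"
    then show ?thesis using m by blast
  next
    assume mx: "(m, x) \<in> M"
    have "(n, x) \<in> M" if "n \<in> D" for n
      using transD[OF tr] m(2) mx that by blast
    then show ?thesis using xx by blast
  qed
qed

lemma Linear_order_exp_order:
  assumes L: "Linear_order L" and M: "Linear_order M"
  shows "Linear_order (exp_order L a M)"
proof -
  let ?C = "exp_carrier L a M"
  have L': "\<And>x y. x \<in> Field L \<Longrightarrow> y \<in> Field L \<Longrightarrow> (x, y) \<in> L \<or> (y, x) \<in> L"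
    using L unfolding order_on_defs refl_on_def total_on_def by metis
  have anL: "antisym L" and trL: "trans L" and anM: "antisym M" and trM: "trans M"
    using L M by (auto simp: order_on_defs)
  have totM: "(m, n) \<in> M \<or> (n, m) \<in> M" if "m \<in> Field M" "n \<in> Field M" for m n
    using M that unfolding order_on_defs refl_on_def total_on_def by metis
  have asym: False if "exp_less L M f g" "exp_less L M g f" for f g
    using that antisymD[OF anM] antisymD[OF anL] unfolding exp_less_def by (metis DiffD1)
  have trans: "exp_less L M f h" if fg: "exp_less L M f g" and gh: "exp_less L M g h" for f g h
  proof -
    obtain m where m: "m \<in> Field M" "\<And>n. n \<in> Field M \<Longrightarrow> f n \<noteq> g n \<Longrightarrow> (n, m) \<in> M"
      "(f m, g m) \<in> L" "f m \<noteq> g m"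
      using fg unfolding exp_less_def by auto
    obtain k where k: "k \<in> Field M" "\<And>n. n \<in> Field M \<Longrightarrow> g n \<noteq> h n \<Longrightarrow> (n, k) \<in> M"
      "(g k, h k) \<in> L" "g k \<noteq> h k"
      using gh unfolding exp_less_def by auto
    consider "m = k" | "(m, k) \<in> M" "m \<noteq> k" | "(k, m) \<in> M" "m \<noteq> k"
      using totM m(1) k(1) by blast
    then show ?thesis
    proof cases
      case 1
      have "(f m, h m) \<in> L"
        using m(3) k(3) transD[OF trL] 1 by blast
      moreover have "f m \<noteq> h m"
        using m(3,4) k(3) antisymD[OF anL] 1 by metis
      moreover have "(n, m) \<in> M" if "n \<in> Field M" "f n \<noteq> h n" for n
        using that m(2) k(2) 1 by metis
      ultimately show ?thesis
        unfolding exp_less_def using m(1) by (intro bexI[of _ m]) auto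
    next
      case 2
      then have "f k = g k"
        using m(1,2) k(1,2) antisymD[OF anM] 2 by blast
      moreover have "(n, k) \<in> M" if "n \<in> Field M" "f n \<noteq> h n" for n
        using that m(2)[of n] k(2)[of n] 2 transD[OF trM] by metis
      ultimately show ?thesis
        unfolding exp_less_def using k by (intro bexI[of _ k]) auto
    next
      case 3
      then have "g m = h m"
        using m(1,2) k(1,2) antisymD[OF anM] 3 by blast
      moreover have "(n, m) \<in> M" if "n \<in> Field M" "f n \<noteq> h n" for n
        using that m(2)[of n] k(2)[of n] 3 transD[OF trM] by metis
      ultimately show ?thesis
        unfolding exp_less_def using m by (intro bexI[of _ m]) auto
    qed
  qed
  have tot: "exp_less L M f g \<or> exp_less L M g f" if f: "f \<in> ?C" and g: "g \<in> ?C" and "f \<noteq> g" for f g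
  proof -
    let ?D = "{m \<in> Field M. f m \<noteq> g m}"
    have "?D \<subseteq> {m \<in> Field M. f m \<noteq> a} \<union> {m \<in> Field M. g m \<noteq> a}" by auto
    then have "finite ?D"
      using f g unfolding exp_carrier_def by (auto intro: finite_subset)
    moreover have "?D \<noteq> {}"
      using f g \<open>f \<noteq> g\<close> unfolding exp_carrier_def by (auto intro: PiE_ext)
    ultimately obtain m where m: "m \<in> ?D" "\<forall>n \<in> ?D. (n, m) \<in> M"
      using finite_has_greatest[OF M, of ?D] by blast
    have "f m \<in> Field L" "g m \<in> Field L"
      using f g m unfolding exp_carrier_def by auto
    then have "(f m, g m) \<in> L \<or> (g m, f m) \<in> L"
      by (rule L')
    then show ?thesis
      using m unfolding exp_less_def by fastforce
  qed
  have "refl_on ?C (exp_order L a M)" "exp_order L a M \<subseteq> ?C \<times> ?C"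
    unfolding refl_on_def exp_order_def by auto
  moreover have "trans (exp_order L a M)"
    unfolding trans_def exp_order_def using trans by blast
  moreover have "antisym (exp_order L a M)"
    unfolding antisym_def exp_order_def using asym by blast
  moreover have "total_on ?C (exp_order L a M)"
    unfolding total_on_def exp_order_def using tot by blast
  ultimately show ?thesis
    by (simp add: order_on_defs)
qed

end

theory Submission
  imports Defs
begin

text \<open>
  For \<open>a \<le> b\<close> take \<open>L = L\<^sub>1 + L\<^sub>2 = L\<^sub>2' + L\<^sub>1'\<close> as in cyclic transitivity and let \<open>R\<close> be the
  union of \<open>F\<^sub>1\<close> and \<open>F\<^sub>2\<close>, a cyclic rotation of \<open>L\<close> with \<open>R a = b\<close>.  Applying \<open>R\<close> to every digit of
  an element of \<open>(L, a)\<^sup>\<alpha>\<close> is not monotone, since \<open>L\<^sub>2\<close> is moved below \<open>L\<^sub>1\<close>; this is repaired by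
  a carry, as in adding a constant to a numeral: a digit in \<open>L\<^sub>2\<close> sends the next digit to its
  immediate successor.  As \<open>L\<close> has no least element, neither has \<open>L\<^sub>2 \<cong> L\<^sub>2'\<close>, so the
  passage from a digit to its successor does not leave \<open>L\<^sub>1\<close> or \<open>L\<^sub>2\<close>.  Hence carries do not
  propagate, and none arises from the digit \<open>a\<close>, which keeps supports finite.
  A carry out of the last digit would be lost, so the digits in the longest finite
  final segment of \<open>\<alpha>\<close> are left alone: finitely many digits do not matter for the support.
\<close>

section \<open>Linear orders, immediate successors, and a criterion for isomorphism of
  exponentials\<close>

lemma Linear_order_cases:
  assumes "Linear_order r" "x \<in> Field r" "y \<in> Field r"
  obtains "(x, y) \<in> r - Id" | "x = y" | "(y, x) \<in> r - Id"
  using assms unfolding order_on_defs total_on_def by blast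

lemma Linear_order_less_le_trans:
  assumes "Linear_order r" "(x, y) \<in> r - Id" "(y, z) \<in> r"
  shows "(x, z) \<in> r - Id"
  using assms unfolding order_on_defs trans_def antisym_def by blast

lemma Linear_order_le_less_trans:
  assumes "Linear_order r" "(x, y) \<in> r" "(y, z) \<in> r - Id"
  shows "(x, z) \<in> r - Id"
  using assms unfolding order_on_defs trans_def antisym_def by blast

lemma Linear_order_less_le_False:
  assumes "Linear_order r" "(x, y) \<in> r - Id" "(y, x) \<in> r"
  shows False
  using assms unfolding order_on_defs antisym_def by blast

lemma Linear_order_refl:
  assumes "Linear_order r" "x \<in> Field r"
  shows "(x, x) \<in> r"
  using assms unfolding order_on_defs refl_on_def by blast

lemma immediate_succ_least:
  assumes "Linear_order r" "immediate_succ r x y" "(x, z) \<in> r - Id"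
  shows "(y, z) \<in> r"
proof -
  have "y \<in> Field r" "z \<in> Field r" and n: "(z, y) \<notin> r - Id"
    using assms(2,3) unfolding immediate_succ_def by (auto intro: FieldI1 FieldI2)
  then show ?thesis
    using assms(1) by (auto elim: Linear_order_cases intro: Linear_order_refl)
qed

lemma immediate_succ_greatest:
  assumes "Linear_order r" "immediate_succ r x y" "(z, y) \<in> r - Id"
  shows "(z, x) \<in> r"
proof -
  have "x \<in> Field r" "z \<in> Field r" and n: "(x, z) \<notin> r - Id"
    using assms(2,3) unfolding immediate_succ_def by (auto intro: FieldI1 FieldI2)
  then show ?thesis
    using assms(1) by (auto elim: Linear_order_cases intro: Linear_order_refl)
qed

lemma immediate_succ_unique:
  assumes "Linear_order r" "immediate_succ r x y" "immediate_succ r x z"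
  shows "y = z"
  using assms immediate_succ_least[OF assms(1)] Linear_order_less_le_False[OF assms(1)]
  unfolding immediate_succ_def by blast

lemma immediate_succ_unique_pred:
  assumes "Linear_order r" "immediate_succ r y x" "immediate_succ r z x"
  shows "y = z"
  using assms immediate_succ_greatest[OF assms(1)] Linear_order_less_le_False[OF assms(1)]
  unfolding immediate_succ_def by blast

lemma Well_order_immediate_succ:
  assumes "Well_order r" "(m, n) \<in> r - Id"
  obtains k where "immediate_succ r m k"
proof -
  have lin: "Linear_order r" and wf: "wf (r - Id)"
    using assms(1) by (auto simp: well_order_on_def)
  from wf assms(2) obtain k where "k \<in> {z. (m, z) \<in> r - Id}"
    "\<And>z. (z, k) \<in> r - Id \<Longrightarrow> z \<notin> {z. (m, z) \<in> r - Id}"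
    by (rule wfE_min[OF _ CollectI]) blast
  then have "immediate_succ r m k"
    unfolding immediate_succ_def by blast
  then show thesis by (rule that)
qed

text \<open>Both exponentials are linear orders, so a strictly monotone map between them is
  injective and reflects the order; only one direction of monotonicity has to be checked.\<close>

lemma exp_less_into_iso:
  assumes L: "Linear_order L" and M: "Linear_order M"
    and into: "\<And>f. f \<in> exp_carrier L a M \<Longrightarrow> F f \<in> exp_carrier L b M"
    and onto: "\<And>g. g \<in> exp_carrier L b M \<Longrightarrow> \<exists>f \<in> exp_carrier L a M. F f = g"
    and mono: "\<And>f g. f \<in> exp_carrier L a M \<Longrightarrow> g \<in> exp_carrier L a M \<Longrightarrow>
      exp_less L M f g \<Longrightarrow> exp_less L M (F f) (F g)"
  shows "iso (exp_order L a M) (exp_order L b M) F"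
proof -
  have irr: "\<not> exp_less L M f f" for f
    unfolding exp_less_def by blast
  have lina: "Linear_order (exp_order L a M)" and linb: "Linear_order (exp_order L b M)"
    using Linear_order_exp_order[OF L M] by auto
  have less: "(F f, F g) \<in> exp_order L b M - Id" if "(f, g) \<in> exp_order L a M - Id" for f g
  proof -
    have "f \<in> exp_carrier L a M" "g \<in> exp_carrier L a M" "exp_less L M f g"
      using that by (auto simp: exp_order_def)
    then have "exp_less L M (F f) (F g)" "F f \<in> exp_carrier L b M" "F g \<in> exp_carrier L b M"
      using mono into by auto
    then show ?thesis
      using irr by (auto simp: exp_order_def)
  qed
  have tri: "(f, g) \<in> exp_order L a M - Id \<or> f = g \<or> (g, f) \<in> exp_order L a M - Id"
    if "f \<in> exp_carrier L a M" "g \<in> exp_carrier L a M" for f g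
    using Linear_order_cases[OF lina] that by (metis Field_exp_order)
  have "inj_on F (exp_carrier L a M)"
    unfolding inj_on_def using less tri by (metis DiffD2 IdI)
  then have "bij_betw F (exp_carrier L a M) (exp_carrier L b M)"
    unfolding bij_betw_def using into onto by blast
  moreover have "(f, g) \<in> exp_order L a M \<longleftrightarrow> (F f, F g) \<in> exp_order L b M"
    if "f \<in> exp_carrier L a M" "g \<in> exp_carrier L a M" for f g
    using tri[OF that] less[of f g] less[of g f] that into[of f]
      Linear_order_less_le_False[OF linb] Linear_order_less_le_False[OF lina]
    by (auto simp: exp_order_def)
  ultimately show ?thesis
    unfolding iso_iff2 by simp
qed

section \<open>Rotation of the digits with a carry\<close>

text \<open>The set \<open>U\<close> plays the role of \<open>L\<^sub>2\<close>, and \<open>s\<close> is the successor function.\<close>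

locale cyclic_rotation =
  fixes L :: "'a rel" and s R :: "'a \<Rightarrow> 'a" and U :: "'a set"
  assumes lin: "Linear_order L"
    and s_bij: "bij_betw s (Field L) (Field L)"
    and s_greater: "x \<in> Field L \<Longrightarrow> (x, s x) \<in> L - Id"
    and s_least: "(x, y) \<in> L - Id \<Longrightarrow> (s x, y) \<in> L"
    and s_U: "x \<in> Field L \<Longrightarrow> s x \<in> U \<longleftrightarrow> x \<in> U"
    and R_bij: "bij_betw R (Field L) (Field L)"
    and U_up: "x \<in> U \<Longrightarrow> (x, y) \<in> L \<Longrightarrow> y \<in> U"
    and R_less: "(x, y) \<in> L - Id \<Longrightarrow> x \<in> U \<longleftrightarrow> y \<in> U \<Longrightarrow> (R x, R y) \<in> L - Id"
    and R_swap: "x \<in> Field L - U \<Longrightarrow> y \<in> Field L \<inter> U \<Longrightarrow> (R y, R x) \<in> L - Id"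
begin

lemma s_less: "(x, y) \<in> L - Id \<Longrightarrow> (s x, s y) \<in> L - Id"
  by (meson FieldI2 DiffD1 s_least s_greater Linear_order_le_less_trans lin)

text \<open>If the ordinal is \<lambda> + n with \<lambda> zero or a limit and n finite, these are
  its last n positions.\<close>

definition finite_tail :: "'b rel \<Rightarrow> 'b set" where
  "finite_tail \<alpha> = {m \<in> Field \<alpha>. finite {n. (m, n) \<in> \<alpha>}}"

text \<open>Limit positions and the least position have no immediate predecessor and never receive a
  carry. The test reads the original digit \<open>f n\<close>, not the digit after a carry into
  \<open>n\<close>, so no recursion along the ordinal is needed.\<close>

definition carry :: "'b rel \<Rightarrow> ('b \<Rightarrow> 'a) \<Rightarrow> 'b \<Rightarrow> bool" where
  "carry \<alpha> f m \<longleftrightarrow> (\<exists>n. immediate_succ \<alpha> n m \<and> f n \<in> U)"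

definition shift :: "'b rel \<Rightarrow> ('b \<Rightarrow> 'a) \<Rightarrow> 'b \<Rightarrow> 'a" where
  "shift \<alpha> f m = (if carry \<alpha> f m then s (f m) else f m)"

definition rotate_exp :: "'b rel \<Rightarrow> ('b \<Rightarrow> 'a) \<Rightarrow> 'b \<Rightarrow> 'a" where
  "rotate_exp \<alpha> f =
     restrict (\<lambda>m. if m \<in> finite_tail \<alpha> then f m else R (shift \<alpha> f m)) (Field \<alpha>)"

section \<open>The final segment that is left alone\<close>

lemma finite_tail_up:
  assumes "Linear_order \<alpha>" "m \<in> finite_tail \<alpha>" "(m, n) \<in> \<alpha>"
  shows "n \<in> finite_tail \<alpha>"
proof -
  have "{k. (n, k) \<in> \<alpha>} \<subseteq> {k. (m, k) \<in> \<alpha>}"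
    using assms(1,3) unfolding order_on_defs trans_def by blast
  then show ?thesis
    using assms(2,3) finite_subset unfolding finite_tail_def by (auto intro: FieldI2)
qed

text \<open>Stepping down to the predecessor adds one element to the upper set. Hence no carry from
  a rotated position crosses into the tail and gets lost.\<close>

lemma finite_tail_pred:
  assumes "Linear_order \<alpha>" "immediate_succ \<alpha> n m" "m \<in> finite_tail \<alpha>"
  shows "n \<in> finite_tail \<alpha>"
proof -
  have "{k. (n, k) \<in> \<alpha>} \<subseteq> insert n {k. (m, k) \<in> \<alpha>}"
    using immediate_succ_least[OF assms(1,2)] by blast
  then have "finite {k. (n, k) \<in> \<alpha>}"
    using assms(3) finite_subset unfolding finite_tail_def by auto
  then show ?thesis
    using assms(2) unfolding finite_tail_def immediate_succ_def by (auto intro: FieldI1)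
qed

text \<open>Well-foundedness gives a nonempty tail a least element, whose finite upper set contains
  the whole tail.\<close>

lemma finite_finite_tail:
  assumes "Well_order \<alpha>"
  shows "finite (finite_tail \<alpha>)"
proof (cases "finite_tail \<alpha> = {}")
  case False
  have lin: "Linear_order \<alpha>" and wf: "wf (\<alpha> - Id)"
    using assms by (auto simp: well_order_on_def)
  obtain m where m: "m \<in> finite_tail \<alpha>" "\<And>n. (n, m) \<in> \<alpha> - Id \<Longrightarrow> n \<notin> finite_tail \<alpha>"
    using wfE_min'[OF wf False] by blast
  have "finite_tail \<alpha> \<subseteq> {n. (m, n) \<in> \<alpha>}"
  proof
    fix n assume n: "n \<in> finite_tail \<alpha>"
    then have "m \<in> Field \<alpha>" "n \<in> Field \<alpha>"
      using m(1) by (auto simp: finite_tail_def)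
    with lin show "n \<in> {n. (m, n) \<in> \<alpha>}"
      using m(2) n by (auto elim: Linear_order_cases intro: Linear_order_refl)
  qed
  then show ?thesis
    using m(1) finite_subset unfolding finite_tail_def by auto
qed simp

text \<open>Every rotated position has a rotated position next to it that can receive its
  carry.\<close>

lemma infinite_tail_succ:
  assumes "Well_order \<alpha>" "m \<in> Field \<alpha>" "m \<notin> finite_tail \<alpha>"
  obtains k where "immediate_succ \<alpha> m k" "k \<in> Field \<alpha>" "k \<notin> finite_tail \<alpha>"
proof -
  have "infinite {n. (m, n) \<in> \<alpha>}"
    using assms(2,3) unfolding finite_tail_def by auto
  then have "\<not> {n. (m, n) \<in> \<alpha>} \<subseteq> {m}"
    using finite_subset by blast
  then obtain n where "(m, n) \<in> \<alpha> - Id" by blast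
  then obtain k where k: "immediate_succ \<alpha> m k"
    using Well_order_immediate_succ[OF assms(1)] by blast
  then have "k \<in> Field \<alpha>"
    unfolding immediate_succ_def by (auto intro: FieldI2)
  moreover have "k \<notin> finite_tail \<alpha>"
    using finite_tail_pred[OF _ k] assms(1,3) by (auto simp: well_order_on_def)
  ultimately show thesis using that k by blast
qed

section \<open>Rotation with carry is an isomorphism of exponentials\<close>

lemma shift_Field: "f m \<in> Field L \<Longrightarrow> shift \<alpha> f m \<in> Field L"
  using s_bij unfolding shift_def by (auto simp: bij_betw_def)

text \<open>Carries do not propagate: the digits before and after an incoming carry emit the same
  carry.\<close>

lemma shift_U: "f m \<in> Field L \<Longrightarrow> shift \<alpha> f m \<in> U \<longleftrightarrow> f m \<in> U"
  unfolding shift_def by (simp add: s_U)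

lemma carry_iff:
  assumes "Linear_order \<alpha>" "immediate_succ \<alpha> n m"
  shows "carry \<alpha> f m \<longleftrightarrow> f n \<in> U"
  using assms immediate_succ_unique_pred[OF assms] unfolding carry_def by metis

text \<open>Outside the tail, a digit \<open>a\<close> can become something other than
  \<open>R a\<close> only by an incoming carry. As \<open>a\<close> is not in \<open>U\<close>, such
  a carry comes from a position in the support of \<open>f\<close>, so the new support adds at most
  the successors of the old one.\<close>

lemma rotate_exp_carrier:
  assumes \<alpha>: "Well_order \<alpha>" and a: "a \<in> Field L - U" and f: "f \<in> exp_carrier L a \<alpha>"
  shows "rotate_exp \<alpha> f \<in> exp_carrier L (R a) \<alpha>"
proof -
  have lin\<alpha>: "Linear_order \<alpha>"
    using \<alpha> by (simp add: well_order_on_def)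
  define D where "D = {m \<in> Field \<alpha>. f m \<noteq> a}"
  have D: "finite D" and fL: "\<And>m. m \<in> Field \<alpha> \<Longrightarrow> f m \<in> Field L"
    using f unfolding exp_carrier_def D_def by auto
  \<comment> \<open>Where there is no successor the value of \<open>THE\<close> is arbitrary; this
    is harmless, since \<open>S\<close> serves only to bound a set by the finite image of
    \<open>D\<close>.\<close>
  define S where "S = (\<lambda>n. THE m. immediate_succ \<alpha> n m)"
  have "{m \<in> Field \<alpha>. rotate_exp \<alpha> f m \<noteq> R a} \<subseteq> finite_tail \<alpha> \<union> D \<union> S ` D"
  proof
    fix m assume "m \<in> {m \<in> Field \<alpha>. rotate_exp \<alpha> f m \<noteq> R a}"
    then have m: "m \<in> Field \<alpha>" "rotate_exp \<alpha> f m \<noteq> R a" by auto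
    show "m \<in> finite_tail \<alpha> \<union> D \<union> S ` D"
    proof (rule ccontr)
      assume n: "m \<notin> finite_tail \<alpha> \<union> D \<union> S ` D"
      then have "f m = a" "carry \<alpha> f m"
        using m unfolding rotate_exp_def shift_def D_def by (auto split: if_splits)
      then obtain k where k: "immediate_succ \<alpha> k m" "f k \<in> U"
        unfolding carry_def by blast
      then have "k \<in> D"
        using a unfolding D_def immediate_succ_def by (auto intro: FieldI1)
      moreover have "S k = m"
        unfolding S_def using k(1) immediate_succ_unique[OF lin\<alpha>] by blast
      ultimately show False using n by blast
    qed
  qed
  then have "finite {m \<in> Field \<alpha>. rotate_exp \<alpha> f m \<noteq> R a}"
    using D finite_finite_tail[OF \<alpha>] by (auto intro: finite_subset)
  moreover have "rotate_exp \<alpha> f \<in> Field \<alpha> \<rightarrow>\<^sub>E Field L"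
    using fL bij_betw_apply[OF R_bij shift_Field[of f]] unfolding rotate_exp_def by auto
  ultimately show ?thesis
    unfolding exp_carrier_def by blast
qed

text \<open>The preimage is explicit: undo \<open>R\<close> digitwise, read off the carries from the
  result, and take the predecessor where a carry came in. Supports stay finite for the same reason
  as in \<open>rotate_exp_carrier\<close>.\<close>

lemma rotate_exp_onto:
  assumes \<alpha>: "Well_order \<alpha>" and a: "a \<in> Field L - U" and g: "g \<in> exp_carrier L (R a) \<alpha>"
  shows "\<exists>f \<in> exp_carrier L a \<alpha>. rotate_exp \<alpha> f = g"
proof -
  have lin\<alpha>: "Linear_order \<alpha>"
    using \<alpha> by (simp add: well_order_on_def)
  define D where "D = {m \<in> Field \<alpha>. g m \<noteq> R a}"
  have D: "finite D" and gL: "\<And>m. m \<in> Field \<alpha> \<Longrightarrow> g m \<in> Field L"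
    and gext: "g \<in> extensional (Field \<alpha>)"
    using g unfolding exp_carrier_def D_def by (auto simp: PiE_def)
  define Q where "Q = inv_into (Field L) R"
  define p where "p = inv_into (Field L) s"
  have Q: "Q x \<in> Field L" "R (Q x) = x" if "x \<in> Field L" for x
    using that R_bij unfolding Q_def
    by (auto simp: bij_betw_def f_inv_into_f intro: inv_into_into)
  have p: "p x \<in> Field L" "s (p x) = x" if "x \<in> Field L" for x
    using that s_bij unfolding p_def
    by (auto simp: bij_betw_def f_inv_into_f intro: inv_into_into)
  have QR: "Q (R a) = a"
    using a R_bij unfolding Q_def by (auto simp: bij_betw_def)
  \<comment> \<open>\<open>Q (g n)\<close> is to be the digit of the preimage after its incoming
    carry. It lies on the same side of the cut as the digit before, so \<open>c\<close> is the carry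
    of the preimage, known before the preimage is defined.\<close>
  define c where "c = (\<lambda>m. \<exists>n. immediate_succ \<alpha> n m \<and> Q (g n) \<in> U)"
  define f where "f = restrict (\<lambda>m. if m \<in> finite_tail \<alpha> then g m
    else if c m then p (Q (g m)) else Q (g m)) (Field \<alpha>)"
  define S where "S = (\<lambda>n. THE m. immediate_succ \<alpha> n m)"
  have fL: "f \<in> Field \<alpha> \<rightarrow>\<^sub>E Field L"
    unfolding f_def using gL Q p by auto
  have fU: "f n \<in> U \<longleftrightarrow> Q (g n) \<in> U" if "n \<in> Field \<alpha>" "n \<notin> finite_tail \<alpha>" for n
    using that s_U[of "p (Q (g n))"] gL Q p unfolding f_def by auto
  \<comment> \<open>The tail is closed upwards, so a predecessor of a position outside it is outside
    as well and \<open>fU\<close> applies there.\<close>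
  have carry: "carry \<alpha> f m \<longleftrightarrow> c m" if "m \<notin> finite_tail \<alpha>" for m
  proof -
    have "f n \<in> U \<longleftrightarrow> Q (g n) \<in> U" if n: "immediate_succ \<alpha> n m" for n
    proof (rule fU)
      show "n \<in> Field \<alpha>" "n \<notin> finite_tail \<alpha>"
        using n finite_tail_up[OF lin\<alpha>] \<open>m \<notin> finite_tail \<alpha>\<close>
        unfolding immediate_succ_def by (auto intro: FieldI1)
    qed
    then show ?thesis
      unfolding carry_def c_def by blast
  qed
  have "{m \<in> Field \<alpha>. f m \<noteq> a} \<subseteq> finite_tail \<alpha> \<union> D \<union> S ` D"
  proof
    fix m assume "m \<in> {m \<in> Field \<alpha>. f m \<noteq> a}"
    then have m: "m \<in> Field \<alpha>" "f m \<noteq> a" by auto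
    show "m \<in> finite_tail \<alpha> \<union> D \<union> S ` D"
    proof (rule ccontr)
      assume n: "m \<notin> finite_tail \<alpha> \<union> D \<union> S ` D"
      then have "c m"
        using m QR unfolding f_def D_def by (auto split: if_splits)
      then obtain k where k: "immediate_succ \<alpha> k m" "Q (g k) \<in> U"
        unfolding c_def by blast
      then have "k \<in> D"
        using a QR unfolding D_def immediate_succ_def by (auto intro: FieldI1)
      moreover have "S k = m"
        unfolding S_def using k(1) immediate_succ_unique[OF lin\<alpha>] by blast
      ultimately show False using n by blast
    qed
  qed
  then have "finite {m \<in> Field \<alpha>. f m \<noteq> a}"
    using D finite_finite_tail[OF \<alpha>] by (auto intro: finite_subset)
  then have "f \<in> exp_carrier L a \<alpha>"
    using fL unfolding exp_carrier_def by blast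
  moreover have "rotate_exp \<alpha> f = g"
  proof (rule extensionalityI[OF _ gext])
    show "rotate_exp \<alpha> f \<in> extensional (Field \<alpha>)"
      unfolding rotate_exp_def by simp
    fix m assume m: "m \<in> Field \<alpha>"
    show "rotate_exp \<alpha> f m = g m"
      using m carry[of m] gL[OF m] Q p unfolding rotate_exp_def shift_def f_def by auto
  qed
  ultimately show ?thesis by blast
qed

text \<open>Let \<open>m\<close> be the greatest position where \<open>f\<close> and
  \<open>g\<close> differ. Outside the tail, the images are compared at the successor of
  \<open>m\<close> if only one of the two carries out of \<open>m\<close>, at \<open>m\<close>
  itself if the digits there still differ in the right direction after incoming carries, and
  otherwise at the predecessor of \<open>m\<close>.\<close>

lemma rotate_exp_less:
  assumes \<alpha>: "Well_order \<alpha>" and f: "f \<in> exp_carrier L a \<alpha>" and g: "g \<in> exp_carrier L a \<alpha>"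
    and fg: "exp_less L \<alpha> f g"
  shows "exp_less L \<alpha> (rotate_exp \<alpha> f) (rotate_exp \<alpha> g)"
proof -
  have lin\<alpha>: "Linear_order \<alpha>"
    using \<alpha> by (simp add: well_order_on_def)
  have fL: "f m \<in> Field L" and gL: "g m \<in> Field L" if "m \<in> Field \<alpha>" for m
    using that f g unfolding exp_carrier_def by auto
  let ?F = "rotate_exp \<alpha> f" and ?G = "rotate_exp \<alpha> g"
  have lessI: "exp_less L \<alpha> ?F ?G"
    if "m \<in> Field \<alpha>" "(?F m, ?G m) \<in> L - Id"
      and eq: "\<And>n. (m, n) \<in> \<alpha> - Id \<Longrightarrow> ?F n = ?G n" for m
  proof -
    have "(n, m) \<in> \<alpha>" if "n \<in> Field \<alpha>" "?F n \<noteq> ?G n" for n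
      using lin\<alpha> that \<open>m \<in> Field \<alpha>\<close> eq[of n]
      by (auto elim: Linear_order_cases intro: Linear_order_refl)
    with that show ?thesis
      unfolding exp_less_def by (intro bexI[of _ m]) auto
  qed
  obtain m where m: "m \<in> Field \<alpha>" "(f m, g m) \<in> L - Id"
    and above: "\<And>n. n \<in> Field \<alpha> \<Longrightarrow> f n \<noteq> g n \<Longrightarrow> (n, m) \<in> \<alpha>"
    using fg unfolding exp_less_def by blast
  have above': "f n = g n" if "(m, n) \<in> \<alpha> - Id" for n
    using above[of n] that Linear_order_less_le_False[OF lin\<alpha> that] by (auto intro: FieldI2)
  have mL: "f m \<in> Field L" "g m \<in> Field L"
    using fL gL m(1) by auto
  show ?thesis
  proof (cases "m \<in> finite_tail \<alpha>")
    case True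
    show ?thesis
    proof (rule lessI[OF m(1)])
      show "(?F m, ?G m) \<in> L - Id"
        using True m unfolding rotate_exp_def by auto
      show "?F n = ?G n" if n: "(m, n) \<in> \<alpha> - Id" for n
        using finite_tail_up[OF lin\<alpha> True, of n] n above'[OF n]
        unfolding rotate_exp_def by (auto simp: restrict_def)
    qed
  next
    case False
    obtain k where k: "immediate_succ \<alpha> m k" "k \<in> Field \<alpha>" "k \<notin> finite_tail \<alpha>"
      using infinite_tail_succ[OF \<alpha> m(1) False] .
    have mk: "(m, k) \<in> \<alpha> - Id"
      using k(1) unfolding immediate_succ_def by blast
    \<comment> \<open>A predecessor of a position beyond \<open>k\<close> is at least
      \<open>k\<close>, hence beyond \<open>m\<close>, so the incoming carries agree too.\<close>
    have above_k: "?F n = ?G n" if n: "(k, n) \<in> \<alpha> - Id" for n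
    proof -
      have mn: "(m, n) \<in> \<alpha> - Id"
        using Linear_order_less_le_trans[OF lin\<alpha> mk] n by blast
      have "f j = g j" if j: "immediate_succ \<alpha> j n" for j
        using above' Linear_order_less_le_trans[OF lin\<alpha> mk immediate_succ_greatest[OF lin\<alpha> j n]]
        by blast
      then have "carry \<alpha> f n \<longleftrightarrow> carry \<alpha> g n"
        unfolding carry_def by auto
      then show ?thesis
        using above'[OF mn] unfolding rotate_exp_def shift_def restrict_def by auto
    qed
    have Fm: "?F m = R (shift \<alpha> f m)" "?G m = R (shift \<alpha> g m)"
      using m False unfolding rotate_exp_def by auto
    have Fk: "?F k = R (if f m \<in> U then s (f k) else f k)"
      "?G k = R (if g m \<in> U then s (f k) else f k)"
      using k above'[OF mk] carry_iff[OF lin\<alpha> k(1)] unfolding rotate_exp_def shift_def by auto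
    show ?thesis
    proof (cases "f m \<in> U \<longleftrightarrow> g m \<in> U")
      case False
      then have U: "f m \<notin> U" "g m \<in> U"
        using U_up m(2) by auto
      \<comment> \<open>\<open>R\<close> reverses the digits at \<open>m\<close>, but the higher
        position \<open>k\<close> decides: there \<open>f\<close> and \<open>g\<close> agree and
        only \<open>g\<close> receives a carry. The successor stays on its side of the cut, where
        \<open>R\<close> is increasing.\<close>
      have "(?F k, ?G k) \<in> L - Id"
        using U Fk R_less[OF s_greater[OF fL[OF k(2)]]] s_U[OF fL[OF k(2)]] by auto
      then show ?thesis
        using lessI k(2) above_k by blast
    next
      case same: True
      have above_m: "?F n = ?G n" if n: "(m, n) \<in> \<alpha> - Id" for n
        using immediate_succ_least[OF lin\<alpha> k(1) n] above_k Fk same by (cases "n = k") auto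
      have sameU: "shift \<alpha> f m \<in> U \<longleftrightarrow> shift \<alpha> g m \<in> U"
        using same shift_U[of f, OF mL(1)] shift_U[of g, OF mL(2)] by auto
      show ?thesis
      proof (cases "(shift \<alpha> f m, shift \<alpha> g m) \<in> L - Id")
        case True
        then show ?thesis
          using lessI[OF m(1)] R_less[OF True sameU] above_m Fm by auto
      next
        case False
        \<comment> \<open>With equal carries \<open>s\<close> preserves the strict inequality, and a
          carry into \<open>g\<close> alone enlarges it. So only \<open>f\<close> receives one, and
          then \<open>s (f m)\<close> is at most \<open>g m\<close>, with equality since it is not
          smaller.\<close>
        have *: "carry \<alpha> f m \<and> \<not> carry \<alpha> g m \<and> s (f m) = g m"
          using False m(2) s_less[OF m(2)] s_least[OF m(2)]
            Linear_order_less_le_trans[OF lin m(2)] s_greater[OF mL(2)]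
          unfolding shift_def by (auto split: if_splits)
        then obtain q where q: "immediate_succ \<alpha> q m" "f q \<in> U" "g q \<notin> U"
          using carry_iff[OF lin\<alpha>] unfolding carry_def by blast
        have qm: "(q, m) \<in> \<alpha>" and qF: "q \<in> Field \<alpha>"
          using q(1) unfolding immediate_succ_def by (auto intro: FieldI1)
        have "q \<notin> finite_tail \<alpha>"
          using finite_tail_up[OF lin\<alpha> _ qm] \<open>m \<notin> finite_tail \<alpha>\<close> by blast
        then have Fq: "?F q = R (shift \<alpha> f q)" "?G q = R (shift \<alpha> g q)"
          using qF unfolding rotate_exp_def by auto
        \<comment> \<open>The carry out of \<open>q\<close> has cancelled the difference at
          \<open>m\<close>. At \<open>q\<close> the digit of \<open>f\<close> is in \<open>U\<close>
          and that of \<open>g\<close> is not, also after incoming carries, and \<open>R\<close>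
          puts \<open>U\<close> below its complement.\<close>
        have "(?F q, ?G q) \<in> L - Id"
          unfolding Fq using q(2,3) shift_Field[of f, OF fL[OF qF]] shift_U[of f, OF fL[OF qF]]
            shift_Field[of g, OF gL[OF qF]] shift_U[of g, OF gL[OF qF]]
          by (intro R_swap) auto
        moreover have "?F n = ?G n" if n: "(q, n) \<in> \<alpha> - Id" for n
          using immediate_succ_least[OF lin\<alpha> q(1) n] above_m Fm *
          by (cases "n = m") (auto simp: shift_def)
        ultimately show ?thesis
          using lessI[OF qF] by blast
      qed
    qed
  qed
qed

lemma iso_rotate_exp:
  assumes "Well_order \<alpha>" "a \<in> Field L - U"
  shows "iso (exp_order L a \<alpha>) (exp_order L (R a) \<alpha>) (rotate_exp \<alpha>)"
proof (rule exp_less_into_iso[OF lin])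
  show "Linear_order \<alpha>"
    using assms(1) by (simp add: well_order_on_def)
qed (fact rotate_exp_carrier[OF assms] rotate_exp_onto[OF assms] rotate_exp_less[OF assms(1)])+

end

section \<open>From cyclic transitivity to a rotation\<close>

lemma discrete_unbounded_succ:
  assumes L: "Linear_order L" "discrete_order L" "unbounded_order L"
  obtains s where "bij_betw s (Field L) (Field L)"
    "\<And>x. x \<in> Field L \<Longrightarrow> immediate_succ L x (s x)"
proof -
  \<comment> \<open>Unboundedness excludes the end points excepted in discreteness.\<close>
  have notmax: "\<not> (\<forall>y \<in> Field L. (y, x) \<in> L)" and notmin: "\<not> (\<forall>y \<in> Field L. (x, y) \<in> L)"
    if "x \<in> Field L" for x
    using L(3) that Linear_order_less_le_False[OF L(1)] unfolding unbounded_order_def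
    by (meson DiffD1 FieldI1 FieldI2)+
  have "\<forall>x \<in> Field L. \<exists>y. immediate_succ L x y"
    using L(2) notmax unfolding discrete_order_def by blast
  then obtain s where s: "\<And>x. x \<in> Field L \<Longrightarrow> immediate_succ L x (s x)"
    by metis
  have "inj_on s (Field L)"
    using s immediate_succ_unique_pred[OF L(1)] unfolding inj_on_def by metis
  moreover have "s x \<in> Field L" if "x \<in> Field L" for x
    using s[OF that] unfolding immediate_succ_def by (auto intro: FieldI2)
  moreover have "\<exists>x \<in> Field L. s x = y" if y: "y \<in> Field L" for y
  proof -
    obtain x where x: "immediate_succ L x y"
      using L(2) notmin[OF y] y unfolding discrete_order_def by blast
    then have "x \<in> Field L"
      unfolding immediate_succ_def by (auto intro: FieldI1)
    then show ?thesis
      using immediate_succ_unique[OF L(1) s x] by blast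
  qed
  ultimately have "bij_betw s (Field L) (Field L)"
    unfolding bij_betw_def by blast
  then show thesis using that s by blast
qed

text \<open>The two partial isomorphisms are glued to a rotation with \<open>U\<close> taken to be
  \<open>L2\<close>; the point \<open>a\<close> lies in \<open>L1\<close>, so it emits no
  carry.\<close>

lemma exp_order_iso_of_le:
  assumes L: "Linear_order L" "discrete_order L" "unbounded_order L" "cyclically_transitive L"
    and \<alpha>: "Well_order \<alpha>" and ab: "(a, b) \<in> L"
  shows "\<exists>F. iso (exp_order L a \<alpha>) (exp_order L b \<alpha>) F"
proof -
  obtain s where s_bij: "bij_betw s (Field L) (Field L)"
    and s: "\<And>x. x \<in> Field L \<Longrightarrow> immediate_succ L x (s x)"
    using discrete_unbounded_succ[OF L(1-3)] by blast
  obtain L1 L2 L1' L2' F1 F2 where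
    part: "order_partition L L1 L2" "order_partition L L2' L1'"
    and a1: "a \<in> L1" and F1: "iso (Restr L L1) (Restr L L1') F1"
    and F2: "iso (Restr L L2) (Restr L L2') F2" and Fa: "F1 a = b"
    using L(4) ab unfolding cyclically_transitive_def by metis
  have L1: "L1 \<subseteq> Field L" "\<And>x y. x \<in> L1 \<Longrightarrow> (y, x) \<in> L \<Longrightarrow> y \<in> L1" and L2: "L2 = Field L - L1"
    and L2': "L2' \<subseteq> Field L" "\<And>x y. x \<in> L2' \<Longrightarrow> (y, x) \<in> L \<Longrightarrow> y \<in> L2'"
    and L1': "L1' = Field L - L2'"
    using part unfolding order_partition_def initial_segment_def by auto
  \<comment> \<open>By reflexivity no point is lost on restricting, so \<open>F1\<close> and
    \<open>F2\<close> are bijections between the parts themselves.\<close>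
  have FR: "Field (Restr L A) = A" if "A \<subseteq> Field L" for A
    using that Linear_order_refl[OF L(1)] unfolding Field_def by blast
  have b1: "bij_betw F1 L1 L1'" and m1: "\<And>x y. x \<in> L1 \<Longrightarrow> y \<in> L1 \<Longrightarrow> (x, y) \<in> L \<Longrightarrow> (F1 x, F1 y) \<in> L"
    using F1 FR[OF L1(1)] FR[of L1'] L1' unfolding iso_iff2 by auto
  have b2: "bij_betw F2 L2 L2'" and m2: "\<And>x y. x \<in> L2 \<Longrightarrow> y \<in> L2 \<Longrightarrow> (x, y) \<in> L \<Longrightarrow> (F2 x, F2 y) \<in> L"
    using F2 FR[OF L2'(1)] FR[of L2] L2 unfolding iso_iff2 by auto
  define R where "R = (\<lambda>x. if x \<in> L1 then F1 x else F2 x)"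
  have R1: "R x = F1 x" if "x \<in> L1" for x
    using that by (simp add: R_def)
  have R2: "R x = F2 x" if "x \<in> L2" for x
    using that L2 by (simp add: R_def)
  have "bij_betw R (L1 \<union> L2) (L1' \<union> L2')"
    using b1 b2 L1' R1 R2 by (intro bij_betw_combine) (auto cong: bij_betw_cong)
  moreover have "L1 \<union> L2 = Field L" "L1' \<union> L2' = Field L"
    using L1 L2 L1' L2' by auto
  ultimately have R_bij: "bij_betw R (Field L) (Field L)" by simp
  have R_in: "R x \<in> L1'" if "x \<in> L1" for x
    using b1 that R1 by (auto simp: bij_betw_def)
  have R_in2: "R x \<in> L2'" if "x \<in> L2" for x
    using b2 that R2 by (auto simp: bij_betw_def)
  have sless: "(x, s x) \<in> L - Id" if "x \<in> Field L" for x
    using s[OF that] unfolding immediate_succ_def by blast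
  interpret cyclic_rotation L s R L2
  proof
    show "Linear_order L" by fact
    show "bij_betw s (Field L) (Field L)" "bij_betw R (Field L) (Field L)" by fact+
    show "(x, s x) \<in> L - Id" if "x \<in> Field L" for x
      using that by (rule sless)
    show least: "(s x, y) \<in> L" if "(x, y) \<in> L - Id" for x y
      using immediate_succ_least[OF L(1) s that] that by (auto intro: FieldI1)
    show up: "y \<in> L2" if "x \<in> L2" "(x, y) \<in> L" for x y
      using that L1(2) L2 by (auto intro: FieldI2)
    show "s x \<in> L2 \<longleftrightarrow> x \<in> L2" if x: "x \<in> Field L" for x
    proof
      assume "x \<in> L2" then show "s x \<in> L2" using up sless[OF x] by blast
    next
      assume sx: "s x \<in> L2"
      show "x \<in> L2"
      proof (rule ccontr)
        \<comment> \<open>Otherwise \<open>s x\<close> is the least element of \<open>L2\<close>, so \<open>L2'\<close> and hence \<open>L\<close> has one.\<close>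
        assume "x \<notin> L2"
        then have x1: "x \<in> L1" using x L2 by blast
        have F: "F2 (s x) \<in> L2'"
          using b2 sx by (auto simp: bij_betw_def)
        then obtain c where c: "(c, F2 (s x)) \<in> L - Id"
          using L(3) L2'(1) unfolding unbounded_order_def by blast
        then have "c \<in> L2'" using L2'(2) F by blast
        then obtain z where z: "z \<in> L2" "c = F2 z"
          using b2 by (auto simp: bij_betw_def)
        have "(x, z) \<in> L - Id"
          using L(1) x z(1) x1 L1(2) L2 by (auto elim: Linear_order_cases[of L x z])
        then have "(F2 (s x), c) \<in> L"
          using least m2 sx z by blast
        then show False
          using Linear_order_less_le_False[OF L(1) c] by blast
      qed
    qed
    show "(R x, R y) \<in> L - Id" if xy: "(x, y) \<in> L - Id" and U: "x \<in> L2 \<longleftrightarrow> y \<in> L2" for x y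
    proof -
      have F: "x \<in> Field L" "y \<in> Field L"
        using xy by (auto intro: FieldI1 FieldI2)
      then have "R x \<noteq> R y"
        using R_bij xy by (auto simp: bij_betw_def inj_on_def)
      moreover have "(R x, R y) \<in> L"
        using m1[of x y] m2[of x y] R1 R2 xy U F L2 by (cases "x \<in> L2") auto
      ultimately show ?thesis by blast
    qed
    \<comment> \<open>\<open>R y\<close> lies in the initial segment \<open>L2'\<close> and
      \<open>R x\<close> in its complement.\<close>
    show "(R y, R x) \<in> L - Id" if "x \<in> Field L - L2" "y \<in> Field L \<inter> L2" for x y
    proof -
      have x: "R x \<in> Field L" "R x \<notin> L2'" and y: "R y \<in> L2'" "R y \<in> Field L"
        using that R_in[of x] R_in2[of y] L2 L1' L2'(1) by auto
      then show ?thesis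
        using L(1) L2'(2) by (auto elim: Linear_order_cases[of L "R y" "R x"])
    qed
  qed
  have "R a = b" "a \<in> Field L - L2"
    using a1 Fa R1 L1(1) L2 by auto
  then show ?thesis
    using iso_rotate_exp[OF \<alpha>] by blast
qed

theorem theorem5p1:
  fixes L :: "'a rel" and \<alpha> :: "'b rel" and a b :: 'a
  assumes "Linear_order L"
    and "discrete_order L"
    and "unbounded_order L"
    and "cyclically_transitive L"
    and "Well_order \<alpha>"
    and "a \<in> Field L" and "b \<in> Field L"
  shows "\<exists>F. iso (exp_order L a \<alpha>) (exp_order L b \<alpha>) F"
proof -
  have "(a, b) \<in> L \<or> (b, a) \<in> L"
    using assms(1,6,7) by (auto elim: Linear_order_cases[of L a b] intro: Linear_order_refl)
  then show ?thesis
  proof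
    assume "(a, b) \<in> L"
    then show ?thesis by (rule exp_order_iso_of_le[OF assms(1-5)])
  next
    \<comment> \<open>Cyclic transitivity only moves points upwards, so the isomorphism is built
      from \<open>b\<close> to \<open>a\<close> and then inverted.\<close>
    assume "(b, a) \<in> L"
    then obtain F where "iso (exp_order L b \<alpha>) (exp_order L a \<alpha>) F"
      using exp_order_iso_of_le[OF assms(1-5)] by blast
    then have F: "bij_betw F (exp_carrier L b \<alpha>) (exp_carrier L a \<alpha>)"
      and le: "\<And>f g. f \<in> exp_carrier L b \<alpha> \<Longrightarrow> g \<in> exp_carrier L b \<alpha> \<Longrightarrow>
        (f, g) \<in> exp_order L b \<alpha> \<longleftrightarrow> (F f, F g) \<in> exp_order L a \<alpha>"
      unfolding iso_iff2 by auto
    let ?G = "inv_into (exp_carrier L b \<alpha>) F"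
    have G: "bij_betw ?G (exp_carrier L a \<alpha>) (exp_carrier L b \<alpha>)"
      by (rule bij_betw_inv_into[OF F])
    have "(f, g) \<in> exp_order L a \<alpha> \<longleftrightarrow> (?G f, ?G g) \<in> exp_order L b \<alpha>"
      if "f \<in> exp_carrier L a \<alpha>" "g \<in> exp_carrier L a \<alpha>" for f g
      using le[of "?G f" "?G g"] that bij_betw_apply[OF G] bij_betw_inv_into_right[OF F] by simp
    with G show ?thesis
      unfolding iso_iff2 by auto
  qed
qed

end
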